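(* Let $(q,n)$ be a Dickson pair with $q=p^l$, $p$ prime, and $n>2$; let $g$ be a primitive element of $\mathbb{F}_{q^n}$, and let $b\in DN_g(q,n)$ be such that $b\neq 0$ and $1+b\neq 0$. Let $s,t$ be non-negative integers with $b\in g^{\frac{q^s-1}{q-1}}H$ and $1+b\in g^{\frac{q^t-1}{q-1}}H$, and put $\mu=\gcd(s,t,n)$. Suppose $\mathbf{B}$ is a basis of $D(1,b)$ as a vector space over the prime subfield $\mathbb{F}_p$. Then the following are equivalent: (i) $D(1,b)$ is closed under the field multiplication (i.e. $(D(1,b),+,\cdot)$ is a field); (ii) $u^2\in D(1,b)$ for every $u\in\mathbf{B}$; (iii) $\lvert\mathbf{B}\rvert=l\mu$.
   Context: A pair $(q,n)$ of positive integers is a Dickson pair if $q=p^l$ is a power of a prime $p$, every prime divisor of $n$ divides $q-1$, and $4\nmid n$ whenever $q\equiv 3\pmod 4$. Let $g$ be a primitive element of $\mathbb{F}_{q^n}$ (a generator of $\mathbb{F}_{q^n}^*$) and let $H=\langle g^n\rangle\le \mathbb{F}_{q^n}^*$. The cosets $g^{\frac{q^k-1}{q-1}}H$, $0\le k\le n-1$, are exactly the $n$ distinct cosets of $H$ in $\mathbb{F}_{q^n}^*$. The Dickson nearfield $DN_g(q,n)=(\mathbb{F}_{q^n},+,\circ)$ has the addition of the field and multiplication $0\circ y=0$, and $x\circ y=x\cdot y^{q^k}$ if $x\in g^{\frac{q^k-1}{q-1}}H$ (so $\circ$ is left distributive: $x\circ(y+z)=x\circ y+x\circ z$). Here $\cdot$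 (or juxtaposition) and powers such as $u^2$ refer to the field multiplication. For $a,b\in DN_g(q,n)$ the generalized distributive set is $D(a,b)=\{d\in DN_g(q,n)\mid (a+b)\circ d=a\circ d+b\circ d\}$; it is an additive subgroup, hence an $\mathbb{F}_p$-subspace, of $\mathbb{F}_{q^n}$. *)

theory Defs
  imports Complex_Main "HOL-Number_Theory.Prime_Powers"
begin

definition dickson_pair :: "nat \<Rightarrow> nat \<Rightarrow> bool" where
  "dickson_pair q n \<longleftrightarrow>
     n > 0 \<and> primepow q \<and>
     (\<forall>r. prime r \<and> r dvd n \<longrightarrow> r dvd q - 1) \<and>
     (q mod 4 = 3 \<longrightarrow> \<not> 4 dvd n)"

text \<open>The subgroup of the multiplicative group generated by a nonzero element.\<close>

definition cyclic_subgroup :: "'a::field \<Rightarrow> 'a set" where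
  "cyclic_subgroup x = range (\<lambda>i::int. x powi i)"

definition primitive_element :: "'a::field \<Rightarrow> bool" where
  "primitive_element g \<longleftrightarrow> g \<noteq> 0 \<and> cyclic_subgroup g = UNIV - {0}"

text \<open>The coset of \<open>\<langle>g\<^sup>n\<rangle>\<close> with index \<open>k\<close>; for \<open>q > 1\<close> the division is exact.\<close>

definition dickson_coset :: "'a::field \<Rightarrow> nat \<Rightarrow> nat \<Rightarrow> nat \<Rightarrow> 'a set" where
  "dickson_coset g q n k =
     (\<lambda>h. g ^ ((q ^ k - 1) div (q - 1)) * h) ` cyclic_subgroup (g ^ n)"

text \<open>
  For a Dickson pair and a primitive element of a field with \<open>q ^ n\<close> elements, the cosets with
  indices below \<open>n\<close> partition the nonzero elements, so that the description below is proper.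
\<close>

definition dickson_mult :: "'a::field \<Rightarrow> nat \<Rightarrow> nat \<Rightarrow> 'a \<Rightarrow> 'a \<Rightarrow> 'a" where
  "dickson_mult g q n x y =
     (if x = 0 then 0
      else x * y ^ (q ^ (THE k. k < n \<and> x \<in> dickson_coset g q n k)))"

definition gen_dist_set :: "'a::field \<Rightarrow> nat \<Rightarrow> nat \<Rightarrow> 'a \<Rightarrow> 'a \<Rightarrow> 'a set" where
  "gen_dist_set g q n a b =
     {d. dickson_mult g q n (a + b) d = dickson_mult g q n a d + dickson_mult g q n b d}"

definition is_subfield :: "'a::field set \<Rightarrow> bool" where
  "is_subfield K \<longleftrightarrow>
     0 \<in> K \<and> 1 \<in> K \<and>
     (\<forall>x\<in>K. \<forall>y\<in>K. x - y \<in> K \<and> x * y \<in> K) \<and>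
     (\<forall>x\<in>K. inverse x \<in> K)"

definition prime_subfield :: "'a::field set" where
  "prime_subfield = \<Inter> {K. is_subfield K}"

lemma is_subfield_prime_subfield: "is_subfield (prime_subfield :: 'a::field set)"
  unfolding prime_subfield_def is_subfield_def by blast

text \<open>
  The prime subfield as a type in its own right, so that the library's notions of span and
  linear independence apply to the ambient field as a vector space over it.
\<close>

typedef (overloaded) 'a prime_field = "prime_subfield :: 'a::field set"
  using is_subfield_prime_subfield unfolding is_subfield_def by blast

setup_lifting type_definition_prime_field

instantiation prime_field :: (field) field
begin

lift_definition zero_prime_field :: "'a prime_field" is 0
  using is_subfield_prime_subfield by (auto simp: is_subfield_def)

lift_definition one_prime_field :: "'a prime_field" is 1
  using is_subfield_prime_subfield by (auto simp: is_subfield_def)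

lift_definition minus_prime_field :: "'a prime_field \<Rightarrow> 'a prime_field \<Rightarrow> 'a prime_field" is "(-)"
  using is_subfield_prime_subfield by (auto simp: is_subfield_def)

lift_definition uminus_prime_field :: "'a prime_field \<Rightarrow> 'a prime_field" is uminus
  using is_subfield_prime_subfield by (metis diff_0 is_subfield_def)

lift_definition plus_prime_field :: "'a prime_field \<Rightarrow> 'a prime_field \<Rightarrow> 'a prime_field" is "(+)"
  using is_subfield_prime_subfield by (metis diff_0 diff_minus_eq_add is_subfield_def)

lift_definition times_prime_field :: "'a prime_field \<Rightarrow> 'a prime_field \<Rightarrow> 'a prime_field" is "(*)"
  using is_subfield_prime_subfield by (auto simp: is_subfield_def)

lift_definition inverse_prime_field :: "'a prime_field \<Rightarrow> 'a prime_field" is inverse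
  using is_subfield_prime_subfield by (auto simp: is_subfield_def)

definition divide_prime_field :: "'a prime_field \<Rightarrow> 'a prime_field \<Rightarrow> 'a prime_field" where
  "divide_prime_field x y = x * inverse y"

instance
  by standard (transfer; simp add: algebra_simps; fail | simp add: divide_prime_field_def)+

end

lift_definition prime_scale :: "'a::field prime_field \<Rightarrow> 'a \<Rightarrow> 'a" is "(*)" .

global_interpretation prime_vs: vector_space "prime_scale :: 'a::field prime_field \<Rightarrow> 'a \<Rightarrow> 'a"
  by standard (transfer; simp add: algebra_simps)+

definition prime_basis :: "'a::field set \<Rightarrow> 'a set \<Rightarrow> bool" where
  "prime_basis B V \<longleftrightarrow> prime_vs.independent B \<and> prime_vs.span B = V"

end

theory Submission
  imports Defs "HOL-Number_Theory.Residues" "HOL-Computational_Algebra.Polynomial"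
    "HOL-Library.Cardinality"
begin

text \<open>
  Put \<open>\<phi> x = x ^ q\<close>. Then \<open>D(1,b)\<close> consists of the \<open>d\<close> with \<open>(1 + b) \<phi>\<^sup>t(d) = d + b \<phi>\<^sup>s(d)\<close>, so it
  contains the fixed field \<open>K\<close> of \<open>\<phi>\<^sup>\<mu>\<close>, which has \<open>p ^ (l * \<mu>)\<close> elements. If \<open>u\<close> and \<open>u\<^sup>2\<close> both
  lie in \<open>D(1,b)\<close>, then \<open>\<phi>\<^sup>t(u)\<close> is a weighted mean of \<open>u\<close> and \<open>\<phi>\<^sup>s(u)\<close> whose variance is zero;
  hence \<open>\<phi>\<^sup>s(u) = \<phi>\<^sup>t(u) = u\<close>, that is, \<open>u \<in> K\<close>. Each of the conditions is therefore equivalent to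
  \<open>D(1,b) = K\<close>.
\<close>

subsection \<open>Divisibility of geometric sums\<close>

lemma geometric_sum_add:
  fixes q :: "'a::comm_semiring_1"
  shows "(\<Sum>i<a + b. q ^ i) = (\<Sum>i<a. q ^ i) + q ^ a * (\<Sum>i<b. q ^ i)"
  by (induction b) (simp_all add: algebra_simps power_add)

lemma geometric_sum_mult:
  fixes q :: "'a::comm_semiring_1"
  shows "(\<Sum>i<a * b. q ^ i) = (\<Sum>i<a. q ^ i) * (\<Sum>i<b. (q ^ a) ^ i)"
proof (induction b)
  case (Suc b)
  have "(\<Sum>i<a * Suc b. q ^ i) = (\<Sum>i<a * b + a. q ^ i)"
    by (simp add: add.commute)
  also have "\<dots> = (\<Sum>i<a. q ^ i) * (\<Sum>i<Suc b. (q ^ a) ^ i)"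
    unfolding geometric_sum_add Suc by (simp add: algebra_simps power_mult)
  finally show ?case .
qed simp

lemma geometric_sum_nat_div:
  fixes q :: nat
  assumes "q > 1"
  shows "(q ^ m - 1) div (q - 1) = (\<Sum>i<m. q ^ i)"
proof -
  have "q ^ m - 1 = (q - 1) * (\<Sum>i<m. q ^ i)"
  proof -
    have "int q ^ m - 1 = (int q - 1) * (\<Sum>i<m. int q ^ i)"
      by (rule power_diff_1_eq)
    then have "int (q ^ m - 1) = int ((q - 1) * (\<Sum>i<m. q ^ i))"
      using assms by (simp add: of_nat_diff)
    then show ?thesis
      by (simp only: of_nat_eq_iff)
  qed
  then show ?thesis
    using assms by simp
qed

lemma geometric_sum_cong:
  fixes q r :: nat
  assumes "[q = 1] (mod r)"
  shows "[(\<Sum>i<m. q ^ i) = m] (mod r)"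
proof -
  have "[(\<Sum>i<m. q ^ i) = (\<Sum>i<m. 1)] (mod r)"
    using cong_pow[OF assms] by (intro cong_sum) simp
  then show ?thesis by simp
qed

text \<open>For odd \<open>r\<close> write \<open>q = 1 + r * a\<close>. Modulo \<open>r * r\<close>
  each \<open>q ^ i\<close> is \<open>1 + r * a * i\<close>, and \<open>0 + ... + (r - 1)\<close> is
  a multiple of \<open>r\<close>, so the whole sum is congruent to \<open>r\<close>. For
  \<open>r = 2\<close> the sum is \<open>1 + q\<close>, which is where the condition modulo 4
  enters.\<close>

lemma square_not_dvd_geometric_sum:
  fixes q r :: nat
  assumes "prime r" and q: "[q = 1] (mod r)" and "r = 2 \<Longrightarrow> q mod 4 \<noteq> 3"
  shows "\<not> r * r dvd (\<Sum>i<r. q ^ i)"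
proof (cases "r = 2")
  case True
  have "{..<2::nat} = {0, 1}" by auto
  then show ?thesis
    using True assms(3) by simp presburger
next
  case False
  have "r > 1" using assms(1) by (rule prime_gt_1_nat)
  have "q \<noteq> 0"
    using q \<open>r > 1\<close> by (metis cong_def mod_0 mod_less zero_neq_one)
  then obtain a where a: "q = 1 + r * a"
    using q by (metis cong_to_1_nat dvdE le_add_diff_inverse One_nat_def Suc_leI gr0I)
  have pw: "[q ^ i = 1 + r * a * i] (mod (r * r))" for i
  proof (induction i)
    case (Suc i)
    have "[q * q ^ i = (1 + r * a) * (1 + r * a * i)] (mod (r * r))"
      using Suc a by (intro cong_mult) auto
    moreover have "(1 + r * a) * (1 + r * a * i) = 1 + r * a * Suc i + (r * r) * (a * a * i)"
      by (simp add: algebra_simps)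
    ultimately show ?case
      by (metis cong_def mod_mult_self2 power_Suc)
  qed simp
  have "[(\<Sum>i<r. q ^ i) = (\<Sum>i<r. 1 + r * a * i)] (mod (r * r))"
    by (intro cong_sum pw)
  also have "(\<Sum>i<r. 1 + r * a * i) = r + r * a * (\<Sum>i<r. i)"
    by (simp only: sum.distrib sum_distrib_left) simp
  finally have c: "[(\<Sum>i<r. q ^ i) = r + r * a * (\<Sum>i<r. i)] (mod (r * r))" .
  have "odd r"
    using False assms(1) \<open>r > 1\<close> primes_dvd_imp_eq two_is_prime_nat by blast
  then obtain k where k: "r = 2 * k + 1" by (rule oddE)
  have "(\<Sum>i<Suc j. i) * 2 = j * Suc j" for j :: nat
    by (induction j) auto
  from this[of "2 * k"] have "(\<Sum>i<r. i) = r * k"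
    using k by simp
  then have "r + r * a * (\<Sum>i<r. i) = r + (r * r) * (a * k)"
    by (simp add: algebra_simps)
  with c have "[(\<Sum>i<r. q ^ i) = r] (mod (r * r))"
    by (simp add: cong_def)
  moreover have "\<not> r * r dvd r"
    using \<open>r > 1\<close> by (auto dest: dvd_imp_le)
  ultimately show ?thesis
    using cong_dvd_iff by blast
qed

text \<open>Induction on \<open>n\<close>, removing one prime factor \<open>r\<close>. Modulo
  \<open>r\<close> the sum is \<open>m\<close>, so only \<open>m = r * m'\<close> matters. Then the
  sum is a product of the sum of length \<open>r\<close> for \<open>q\<close> and the sum of length
  \<open>m'\<close> for \<open>q ^ r\<close>. The first factor supplies exactly the one factor
  \<open>r\<close> needed, and the second falls under the induction hypothesis for
  \<open>n' = n / r\<close>.\<close>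

lemma dvd_geometric_sum_iff:
  fixes q n :: nat
  assumes "n > 0" and "\<And>r. prime r \<Longrightarrow> r dvd n \<Longrightarrow> [q = 1] (mod r)"
    and "q mod 4 = 3 \<Longrightarrow> \<not> 4 dvd n"
  shows "n dvd (\<Sum>i<m. q ^ i) \<longleftrightarrow> n dvd m"
  using assms
proof (induction n arbitrary: q m rule: less_induct)
  case (less n)
  show ?case
  proof (cases "n = 1")
    case False
    then obtain r where r: "prime r" "r dvd n"
      using prime_factor_nat by blast
    then obtain n' where n': "n = r * n'" by blast
    have "r > 1" using r(1) by (rule prime_gt_1_nat)
    have q: "[q = 1] (mod r)" using less.prems(2) r by blast
    have "n' > 0" "n' < n" using less.prems(1) n' \<open>r > 1\<close> by auto
    have "r dvd (\<Sum>i<r. q ^ i)"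
      using cong_dvd_iff[OF geometric_sum_cong[OF q, of r]] by simp
    then obtain u where u: "(\<Sum>i<r. q ^ i) = r * u" by blast
    \<comment> \<open>A common prime \<open>r'\<close> divides the sum of length \<open>r\<close>,
      which is \<open>r\<close> modulo \<open>r'\<close>; so \<open>r' = r\<close> and
      \<open>r * r\<close> divides that sum. If \<open>r = 2\<close>, then 4 divides
      \<open>n\<close>, which rules out \<open>q mod 4 = 3\<close>.\<close>
    have "coprime n' u"
    proof (rule ccontr)
      assume "\<not> coprime n' u"
      then obtain r' where r': "prime r'" "r' dvd n'" "r' dvd u"
        by (metis coprime_iff_gcd_eq_1 prime_factor_nat gcd_greatest_iff)
      have "[q = 1] (mod r')" using less.prems(2) r' n' by auto
      then have "r' dvd r"
        using cong_dvd_iff[OF geometric_sum_cong[of q r' r]] u r'(3) by simp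
      then have [simp]: "r' = r" using r' r primes_dvd_imp_eq by blast
      have "r * r dvd (\<Sum>i<r. q ^ i)" using u r' by simp
      moreover have "r = 2 \<Longrightarrow> q mod 4 \<noteq> 3"
        using less.prems(3) n' r'(2) by (auto simp: dvd_def)
      ultimately show False
        using square_not_dvd_geometric_sum[OF r(1) q] by blast
    qed
    have q': "[q ^ r = 1] (mod r')" if "prime r'" "r' dvd n'" for r'
      using cong_pow[OF less.prems(2)[of r'], of r] that n' by simp
    \<comment> \<open>The condition modulo 4 passes to \<open>q ^ r\<close>: an odd \<open>q\<close>
      that is not 3 modulo 4 is 1, and so are its powers.\<close>
    have "\<not> 4 dvd n'" if "q ^ r mod 4 = 3"
    proof -
      have "q mod 4 = 3"
      proof (rule ccontr)
        assume "q mod 4 \<noteq> 3"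
        have "odd (q ^ r)" using that by presburger
        then have "odd q" using \<open>r > 1\<close> by auto
        then have "[q = 1] (mod 4)" using \<open>q mod 4 \<noteq> 3\<close> unfolding cong_def by presburger
        then have "[q ^ r = 1] (mod 4)" using cong_pow[of q 1 4 r] by simp
        then show False using that by (simp add: cong_def)
      qed
      then show ?thesis using less.prems(3) n' by auto
    qed
    then have IH: "n' dvd (\<Sum>i<m'. (q ^ r) ^ i) \<longleftrightarrow> n' dvd m'" for m'
      using less.IH[OF \<open>n' < n\<close> \<open>n' > 0\<close> q'] by blast
    show ?thesis
    proof (cases "r dvd m")
      case True
      then obtain m' where m': "m = r * m'" by blast
      have "n dvd (\<Sum>i<m. q ^ i) \<longleftrightarrow> n' dvd u * (\<Sum>i<m'. (q ^ r) ^ i)"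
        using \<open>r > 1\<close> by (simp add: m' geometric_sum_mult u n' mult.assoc)
      also have "\<dots> \<longleftrightarrow> n dvd m"
        using IH \<open>coprime n' u\<close> \<open>r > 1\<close> by (simp add: coprime_dvd_mult_right_iff m' n')
      finally show ?thesis .
    next
      case False
      then have "\<not> r dvd (\<Sum>i<m. q ^ i)"
        using cong_dvd_iff[OF geometric_sum_cong[OF q, of m]] by simp
      then show ?thesis
        using False r(2) dvd_trans by blast
    qed
  qed simp
qed

text \<open>Two such sums differ by \<open>q ^ a\<close> times a sum of length the difference of the
  indices, and \<open>q\<close> is a unit modulo \<open>n\<close>. This is what separates the
  Dickson cosets.\<close>

lemma cong_geometric_sum_iff:
  fixes q n :: nat
  assumes "n > 0" and q: "\<And>r. prime r \<Longrightarrow> r dvd n \<Longrightarrow> [q = 1] (mod r)"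
    and "q mod 4 = 3 \<Longrightarrow> \<not> 4 dvd n"
  shows "[(\<Sum>i<j. q ^ i) = (\<Sum>i<k. q ^ i)] (mod n) \<longleftrightarrow> [j = k] (mod n)"
proof -
  have cop: "coprime n (q ^ i)" for i
  proof -
    have "coprime n q"
    proof (rule ccontr)
      assume "\<not> coprime n q"
      then obtain r where r: "prime r" "r dvd n" "r dvd q"
        by (metis coprime_iff_gcd_eq_1 prime_factor_nat gcd_greatest_iff)
      then have "r dvd 1" using q cong_dvd_iff by blast
      then show False using r(1) by (simp add: prime_nat_iff)
    qed
    then show ?thesis by simp
  qed
  have *: "[(\<Sum>i<a + d. q ^ i) = (\<Sum>i<a. q ^ i)] (mod n) \<longleftrightarrow> [a + d = a] (mod n)" for a d
  proof -
    have "[(\<Sum>i<a + d. q ^ i) = (\<Sum>i<a. q ^ i)] (mod n) \<longleftrightarrow> n dvd q ^ a * (\<Sum>i<d. q ^ i)"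
      by (metis geometric_sum_add cong_add_lcancel_0_nat cong_0_iff)
    also have "\<dots> \<longleftrightarrow> n dvd d"
      using dvd_geometric_sum_iff[OF assms] cop by (simp add: coprime_dvd_mult_right_iff)
    finally show ?thesis by (metis cong_add_lcancel_0_nat cong_0_iff)
  qed
  show ?thesis
  proof (cases "j \<le> k")
    case True
    then show ?thesis using *[of j "k - j"] by (simp add: cong_sym_eq)
  next
    case False
    then show ?thesis using *[of k "j - k"] by simp
  qed
qed

subsection \<open>Finite fields and their prime subfields\<close>

lemma power_card_eq_self:
  fixes x :: "'a::{field,finite}"
  shows "x ^ CARD('a) = x"
proof (cases "x = 0")
  case False
  \<comment> \<open>Multiplication by \<open>x\<close> permutes the nonzero elements, so their
    product can be cancelled.\<close>
  have "(\<Prod>y\<in>UNIV - {0}. x * y) = \<Prod>(UNIV - {0})"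
    by (rule prod.reindex_bij_witness[of _ "\<lambda>y. y / x" "\<lambda>y. x * y"]) (use False in auto)
  then have "x ^ (CARD('a) - 1) = 1"
    by (simp add: prod.distrib)
  moreover have "x ^ CARD('a) = x * x ^ (CARD('a) - 1)"
    using power_minus_mult[of "CARD('a)" x] zero_less_card_finite by (metis mult.commute)
  ultimately show ?thesis by simp
qed (simp add: zero_less_card_finite)

lemma CHAR_eq_of_CARD_eq_power:
  assumes "CARD('a::{field,finite}) = p ^ k" and "prime p"
  shows "CHAR('a) = p"
proof -
  have "prime CHAR('a)"
    by (simp add: finite_imp_CHAR_pos prime_CHAR_semidom)
  moreover have "CHAR('a) dvd p ^ k"
    using CHAR_dvd_CARD[where 'a = 'a] assms(1) by simp
  ultimately show ?thesis
    using assms(2) by (metis prime_dvd_power primes_dvd_imp_eq)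
qed

text \<open>With \<open>k = q ^ m - 1\<close> and \<open>q ^ n - 1 = k * M\<close>, the polynomial
  \<open>f\<close> has degree at most \<open>k + 1\<close>, which bounds the fixed points from
  above. Every field element is a fixed point or a root of the cofactor \<open>h\<close>, and
  \<open>h\<close> has at most \<open>k * (M - 1)\<close> roots; this leaves at least
  \<open>k + 1\<close> fixed points.\<close>

lemma card_power_fixed_points:
  fixes q m n :: nat
  assumes card: "CARD('a::{field,finite}) = q ^ n" and "m dvd n" "m > 0" "q > 1"
  shows "card {x::'a. x ^ (q ^ m) = x} = q ^ m"
proof -
  define k where "k = q ^ m - 1"
  have "q ^ m > 1" using \<open>m > 0\<close> \<open>q > 1\<close> by (metis one_less_power)
  then have k: "q ^ m = Suc k" "k > 0" by (auto simp: k_def)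
  obtain c where c: "n = m * c" using \<open>m dvd n\<close> by blast
  have "k dvd q ^ n - 1"
  proof -
    have "int q ^ n - 1 = (int q ^ m - 1) * (\<Sum>i<c. (int q ^ m) ^ i)"
      using power_diff_1_eq[of "int q ^ m" c] by (simp add: c power_mult)
    then have "int k dvd int (q ^ n - 1)"
      using \<open>q > 1\<close> by (simp add: k_def of_nat_diff)
    then show ?thesis by simp
  qed
  then obtain M where M: "q ^ n - 1 = k * M" by blast
  have "q ^ n > 0" using \<open>q > 1\<close> by simp
  then have qn: "q ^ n = Suc (k * M)" using M by linarith
  have "M > 0"
  proof (rule ccontr)
    assume "\<not> M > 0"
    then have "CARD('a) = 1" using qn card by simp
    moreover have "card {0, 1::'a} \<le> CARD('a)" by (rule card_mono) auto
    ultimately show False by simp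
  qed
  let ?F = "{x::'a. x ^ (q ^ m) = x}"
  define f :: "'a poly" where "f = monom 1 (Suc k) - monom 1 1"
  define h :: "'a poly" where "h = (\<Sum>i<M. monom 1 (k * i))"
  have "coeff f (Suc k) = 1" using k by (simp add: f_def)
  then have "f \<noteq> 0" by auto
  have "degree f \<le> Suc k"
    unfolding f_def by (intro degree_diff_le order.trans[OF degree_monom_le]) auto
  moreover have "?F = {x. poly f x = 0}"
    by (simp add: f_def poly_monom k)
  ultimately have upper: "card ?F \<le> Suc k"
    using card_poly_roots_bound[OF \<open>f \<noteq> 0\<close>] by simp
  \<comment> \<open>Since \<open>k > 0\<close>, only the summand with \<open>i = 0\<close>
    contributes to the constant term.\<close>
  have "coeff h 0 = (\<Sum>i<M. if i = 0 then 1 else 0)"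
    unfolding h_def coeff_sum using k by (intro sum.cong) auto
  also have "\<dots> = 1" using \<open>M > 0\<close> by (simp add: sum.delta)
  finally have "h \<noteq> 0" by auto
  have "degree h \<le> k * (M - 1)"
    unfolding h_def
    by (intro degree_sum_le order.trans[OF degree_monom_le] mult_le_mono2) auto
  then have roots_h: "card {x. poly h x = 0} \<le> k * (M - 1)"
    using card_poly_roots_bound[OF \<open>h \<noteq> 0\<close>] by simp
  have "x \<in> ?F \<or> poly h x = 0" for x
  proof (cases "x = 0")
    case False
    have "x ^ Suc (k * M) = x" using power_card_eq_self[of x] card qn by simp
    then have "(x ^ k) ^ M - 1 = 0" using False by (simp add: power_mult)
    then have "(x ^ k - 1) * (\<Sum>i<M. (x ^ k) ^ i) = 0"
      using power_diff_1_eq[of "x ^ k" M] by simp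
    moreover have "poly h x = (\<Sum>i<M. (x ^ k) ^ i)"
      by (simp add: h_def poly_sum poly_monom power_mult)
    ultimately show ?thesis by (auto simp: k)
  qed (use k in auto)
  then have "(UNIV :: 'a set) = ?F \<union> {x. poly h x = 0}" by blast
  then have "CARD('a) \<le> card ?F + card {x. poly h x = 0}"
    using card_Un_le by metis
  then have "Suc (k * M) \<le> card ?F + k * (M - 1)"
    using roots_h card qn by linarith
  moreover have "k * M = k * (M - 1) + k" using \<open>M > 0\<close> by (cases M) auto
  ultimately show ?thesis using upper k by linarith
qed

lemma is_subfield_power_fixed_points:
  assumes "prime CHAR('a::field)" and "Q = CHAR('a) ^ k"
  shows "is_subfield {x::'a. x ^ Q = x}"
proof -
  have add: "(x + y) ^ Q = x ^ Q + y ^ Q" for x y :: 'a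
    using freshmans_dream'[OF assms] .
  have "(x - y) ^ Q = x ^ Q - y ^ Q" for x y :: 'a
    using add[of "x - y" y] by simp
  moreover have "Q > 0" using assms prime_gt_0_nat by simp
  ultimately show ?thesis
    unfolding is_subfield_def by (auto simp: power_mult_distrib power_inverse)
qed

lemma is_subfield_add:
  assumes "is_subfield K" "x \<in> K" "y \<in> K"
  shows "x + y \<in> K"
  using assms unfolding is_subfield_def by (metis diff_0 diff_minus_eq_add)

text \<open>The fixed points of the \<open>p\<close>-th power form a subfield with \<open>p\<close>
  elements, hence the upper bound. The images of \<open>0, ..., p - 1\<close> lie in every subfield
  and are distinct in characteristic \<open>p\<close>, hence the lower bound.\<close>

lemma card_prime_subfield:
  assumes "CARD('a::{field,finite}) = p ^ k" and "prime p"
  shows "card (prime_subfield :: 'a set) = p"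
proof -
  have p: "CHAR('a) = p" using CHAR_eq_of_CARD_eq_power[OF assms] .
  have "k > 0"
  proof (rule ccontr)
    assume "\<not> k > 0"
    then have "CARD('a) = 1" using assms by simp
    moreover have "card {0, 1::'a} \<le> CARD('a)" by (rule card_mono) auto
    ultimately show False by simp
  qed
  then have cF: "card {x::'a. x ^ p = x} = p"
    using card_power_fixed_points[OF assms(1), of 1] prime_gt_1_nat[OF assms(2)] by simp
  have "is_subfield {x::'a. x ^ p = x}"
    using assms(2) by (intro is_subfield_power_fixed_points[where k = 1]) (simp_all only: p power_one_right)
  then have "prime_subfield \<subseteq> {x::'a. x ^ p = x}"
    unfolding prime_subfield_def by blast
  then have upper: "card (prime_subfield :: 'a set) \<le> p"
    using card_mono[of "{x::'a. x ^ p = x}" prime_subfield] cF by simp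
  have "of_nat i \<in> (prime_subfield :: 'a set)" for i
    using is_subfield_prime_subfield[where 'a = 'a] is_subfield_add[of "prime_subfield :: 'a set"]
    by (induction i) (simp_all add: is_subfield_def)
  then have "of_nat ` {..<p} \<subseteq> (prime_subfield :: 'a set)" by blast
  moreover have "inj_on (of_nat :: nat \<Rightarrow> 'a) {..<p}"
    by (auto simp: inj_on_def of_nat_eq_iff_cong_CHAR p cong_def)
  ultimately have "p \<le> card (prime_subfield :: 'a set)"
    using card_mono[of "prime_subfield :: 'a set" "of_nat ` {..<p}"] by (simp add: card_image)
  with upper show ?thesis by simp
qed

section \<open>Cardinalities of spans over finite scalar fields\<close>

context vector_space
begin

lemma card_span_independent:
  assumes "finite B" and indep: "independent B"
  shows "card (span B) = CARD('a) ^ card B"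
proof -
  let ?f = "\<lambda>u. \<Sum>v\<in>B. scale (u v) v"
  have inj: "inj_on ?f (B \<rightarrow>\<^sub>E UNIV)"
  proof (rule inj_onI)
    fix u w assume u: "u \<in> B \<rightarrow>\<^sub>E (UNIV::'a set)" and w: "w \<in> B \<rightarrow>\<^sub>E (UNIV::'a set)"
      and "?f u = ?f w"
    then have "(\<Sum>v\<in>B. scale (u v - w v) v) = 0"
      by (simp add: scale_left_diff_distrib sum_subtractf)
    then have "u v - w v = 0" if "v \<in> B" for v
      using independentD[OF indep \<open>finite B\<close>, of "\<lambda>v. u v - w v"] that by blast
    then show "u = w"
      using PiE_ext[OF u w] by simp
  qed
  have image: "?f ` (B \<rightarrow>\<^sub>E UNIV) = span B"
  proof -
    \<comment> \<open>Values of \<open>u\<close> outside \<open>B\<close> do not affect the sum, so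
      coefficient functions may be restricted to \<open>B\<close>; this makes coordinates unique as
      functions.\<close>
    have "?f u \<in> ?f ` (B \<rightarrow>\<^sub>E UNIV)" for u
      by (rule image_eqI[of _ _ "restrict u B"]) auto
    then show ?thesis unfolding span_finite[OF \<open>finite B\<close>] by blast
  qed
  show ?thesis
    using card_image[OF inj] unfolding image by (simp add: card_PiE \<open>finite B\<close>)
qed

end

lemma card_prime_basis:
  fixes B V :: "'a::{field,finite} set"
  assumes "CARD('a) = p ^ k" and "prime p" and "prime_basis B V"
  shows "card V = p ^ card B"
proof -
  have "CARD('a prime_field) = card (prime_subfield :: 'a set)"
    using type_definition.card[OF type_definition_prime_field] .
  then show ?thesis
    using prime_vs.card_span_independent[of B] assms card_prime_subfield[OF assms(1,2)]
    by (simp add: prime_basis_def)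
qed

text \<open>A subfield contains the prime subfield, so it is a subspace over it.\<close>

lemma prime_span_subset_subfield:
  assumes K: "is_subfield K" and "B \<subseteq> K"
  shows "prime_vs.span B \<subseteq> K"
proof (rule prime_vs.span_minimal[OF \<open>B \<subseteq> K\<close>])
  have "prime_subfield \<subseteq> K" using K unfolding prime_subfield_def by blast
  then have "prime_scale c x \<in> K" if "x \<in> K" for c x
    using that K Rep_prime_field[of c] by (auto simp: prime_scale.rep_eq is_subfield_def)
  then show "prime_vs.subspace K"
    using K is_subfield_add[OF K] by (auto simp: prime_vs.subspace_def is_subfield_def)
qed

subsection \<open>Dickson multiplication\<close>

lemma powi_eq_1_iff_primitive:
  fixes g :: "'a::{field,finite}"
  assumes g: "primitive_element g"
  shows "g powi z = 1 \<longleftrightarrow> int (CARD('a) - 1) dvd z"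
proof -
  let ?N = "CARD('a) - 1"
  have "g \<noteq> 0" and surj: "range (\<lambda>i::int. g powi i) = UNIV - {0}"
    using g by (auto simp: primitive_element_def cyclic_subgroup_def)
  have "card {0, 1::'a} \<le> CARD('a)" by (rule card_mono) auto
  then have "?N > 0" by simp
  \<comment> \<open>Used twice: for the group order, and for a hypothetical smaller exponent
    \<open>d\<close>.\<close>
  have period: "g powi z = g powi (z mod d)" if "g powi d = 1" for d z :: int
  proof -
    have "g powi (d * (z div d) + z mod d) = g powi (z mod d)"
      using \<open>g \<noteq> 0\<close> that by (simp only: power_int_add power_int_mult simp_thms) simp
    then show ?thesis by simp
  qed
  have "g * g ^ ?N = g * 1"
    using power_card_eq_self[of g] \<open>?N > 0\<close> by (simp flip: power_Suc)
  then have gN: "g powi int ?N = 1"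
    using \<open>g \<noteq> 0\<close> unfolding power_int_of_nat by simp
  show ?thesis
  proof
    assume "int ?N dvd z"
    then show "g powi z = 1" using gN by (auto simp: power_int_mult)
  next
    assume "g powi z = 1"
    define d where "d = z mod int ?N"
    have d: "0 \<le> d" "d < int ?N" using \<open>?N > 0\<close> by (simp_all add: d_def)
    have gd: "g powi d = 1" using period[OF gN, of z] \<open>g powi z = 1\<close> by (simp add: d_def)
    have "d = 0"
    proof (rule ccontr)
      assume "d \<noteq> 0"
      \<comment> \<open>If \<open>g powi d = 1\<close> with \<open>0 < d\<close>, the powers of
        \<open>g\<close> take at most \<open>d\<close> values, too few to cover all nonzero
        elements.\<close>
      have "UNIV - {0} \<subseteq> (\<lambda>i. g powi i) ` {0..<d}"
      proof
        fix x assume "x \<in> UNIV - {0::'a}"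
        then obtain i :: int where "x = g powi i" using surj by blast
        then have "x = g powi (i mod d)" using period[OF gd] by simp
        then show "x \<in> (\<lambda>i. g powi i) ` {0..<d}"
          using d \<open>d \<noteq> 0\<close> by simp
      qed
      then have "?N \<le> card {0..<d}"
        using surj_card_le[of "{0..<d}"] by (metis card_Diff_singleton UNIV_I finite_atLeastLessThan_int)
      then show False using d by simp
    qed
    then show "int ?N dvd z" by (simp add: d_def dvd_eq_mod_eq_0)
  qed
qed

text \<open>Turns questions about cosets into congruences modulo \<open>n\<close> between exponents
  of \<open>g\<close>.\<close>

lemma mem_dickson_coset_iff:
  fixes g :: "'a::field"
  assumes "g \<noteq> 0" "q > 1"
  shows "x \<in> dickson_coset g q n k \<longleftrightarrow> (\<exists>z. x = g powi (int (\<Sum>i<k. q ^ i) + int n * z))"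
  unfolding dickson_coset_def cyclic_subgroup_def geometric_sum_nat_div[OF \<open>q > 1\<close>]
  using \<open>g \<noteq> 0\<close> by (auto simp: power_int_add power_int_mult simp flip: power_int_of_nat)

locale dickson =
  fixes g :: "'a::{field,finite}" and q n :: nat
  assumes pair: "dickson_pair q n"
    and card: "CARD('a) = q ^ n"
    and primitive: "primitive_element g"
begin

lemma q_gt_1: "q > 1" and n_pos: "n > 0"
  using pair primepow_gt_Suc_0[of q] by (auto simp: dickson_pair_def)

lemma q_cong_1: "[q = 1] (mod r)" if "prime r" "r dvd n"
  using pair that q_gt_1 cong_altdef_nat[of 1 q r] by (simp add: dickson_pair_def)

lemma not_4_dvd: "\<not> 4 dvd n" if "q mod 4 = 3"
  using pair that by (simp add: dickson_pair_def)

text \<open>Exponents of \<open>g\<close> are determined only modulo \<open>q ^ n - 1\<close>; this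
  divisibility makes their residues modulo \<open>n\<close> meaningful.\<close>

lemma n_dvd_order: "n dvd q ^ n - 1"
proof -
  have "n dvd (\<Sum>i<n. q ^ i)"
    using dvd_geometric_sum_iff[OF n_pos q_cong_1 not_4_dvd] by simp
  moreover have "int q ^ n - 1 = (int q - 1) * (\<Sum>i<n. int q ^ i)"
    by (rule power_diff_1_eq)
  then have "int (q ^ n - 1) = int ((q - 1) * (\<Sum>i<n. q ^ i))"
    using q_gt_1 by (simp add: of_nat_diff)
  ultimately show ?thesis
    by (simp only: of_nat_eq_iff) simp
qed

text \<open>Equal powers of \<open>g\<close> have exponents congruent modulo \<open>n\<close>, which
  compares the two geometric sums. Hence the index in \<open>dickson_mult\<close> is unique below
  \<open>n\<close>, while arbitrary indices such as \<open>s\<close> and \<open>t\<close> are still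
  covered.\<close>

lemma dickson_coset_index_cong:
  assumes x: "x \<in> dickson_coset g q n j"
  shows "x \<in> dickson_coset g q n k \<longleftrightarrow> [j = k] (mod n)"
proof -
  let ?G = "\<lambda>m. \<Sum>i<m. q ^ i"
  have "g \<noteq> 0" using primitive by (simp add: primitive_element_def)
  note mem = mem_dickson_coset_iff[OF \<open>g \<noteq> 0\<close> q_gt_1]
  obtain y where y: "x = g powi (int (?G j) + int n * y)" using x mem by blast
  have "x \<in> dickson_coset g q n k \<longleftrightarrow> [?G j = ?G k] (mod n)"
  proof
    assume "x \<in> dickson_coset g q n k"
    then obtain z where z: "x = g powi (int (?G k) + int n * z)" using mem by blast
    have "g powi (int (?G j) + int n * y - (int (?G k) + int n * z)) = 1"
      using \<open>g \<noteq> 0\<close> y z by (subst power_int_diff) auto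
    then have "int (q ^ n - 1) dvd int (?G j) + int n * y - (int (?G k) + int n * z)"
      unfolding powi_eq_1_iff_primitive[OF primitive] card .
    moreover have "int n dvd int (q ^ n - 1)" using n_dvd_order by simp
    ultimately have "int n dvd int (?G j) + int n * y - (int (?G k) + int n * z)"
      by (rule dvd_trans[rotated])
    then have "[int (?G j) + int n * y = int (?G k) + int n * z] (mod int n)"
      by (simp add: cong_iff_dvd_diff)
    then have "[int (?G j) = int (?G k)] (mod int n)"
      by (simp add: cong_def)
    then show "[?G j = ?G k] (mod n)" by (simp only: cong_int_iff)
  next
    assume "[?G j = ?G k] (mod n)"
    then have "[int (?G j) = int (?G k)] (mod int n)" by (simp only: cong_int_iff)
    then obtain z where "int (?G j) = int (?G k) + int n * z"
      using cong_iff_lin[THEN iffD1, OF cong_sym] by blast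
    then have "x = g powi (int (?G k) + int n * (z + y))"
      using y by (simp add: algebra_simps)
    then show "x \<in> dickson_coset g q n k" using mem by blast
  qed
  also have "\<dots> \<longleftrightarrow> [j = k] (mod n)"
    by (rule cong_geometric_sum_iff[OF n_pos q_cong_1 not_4_dvd])
  finally show ?thesis .
qed

lemma power_q_mod: "x ^ (q ^ (k mod n)) = x ^ (q ^ k)" for x :: 'a
proof -
  have *: "x ^ (q ^ (n * c)) = x" for c
  proof (induction c)
    case (Suc c)
    have "x ^ (q ^ (n * Suc c)) = (x ^ (q ^ n)) ^ (q ^ (n * c))"
      by (simp add: power_add power_mult)
    then show ?case using Suc power_card_eq_self[of x] card by simp
  qed simp
  have "x ^ (q ^ k) = x ^ (q ^ (n * (k div n) + k mod n))" by simp
  also have "\<dots> = (x ^ (q ^ (n * (k div n)))) ^ (q ^ (k mod n))"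
    by (simp only: power_add power_mult)
  finally show ?thesis using * by simp
qed

lemma dickson_mult_eq:
  assumes x: "x \<in> dickson_coset g q n k"
  shows "dickson_mult g q n x y = x * y ^ (q ^ k)"
proof -
  have "g \<noteq> 0" using primitive by (simp add: primitive_element_def)
  then have "x \<noteq> 0" using x mem_dickson_coset_iff[OF _ q_gt_1] by fastforce
  \<comment> \<open>The index \<open>k\<close> need not be below \<open>n\<close>; the description
    selects its residue, and \<open>power_q_mod\<close> restores \<open>k\<close> in the
    exponent.\<close>
  have "(THE j. j < n \<and> x \<in> dickson_coset g q n j) = k mod n"
    using dickson_coset_index_cong[OF x] n_pos by (intro the_equality) (auto simp: cong_def)
  then show ?thesis using \<open>x \<noteq> 0\<close> power_q_mod by (simp add: dickson_mult_def)
qed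

lemma gen_dist_set_one:
  assumes "b \<in> dickson_coset g q n s" "1 + b \<in> dickson_coset g q n t"
  shows "gen_dist_set g q n 1 b = {d. (1 + b) * d ^ (q ^ t) = d + b * d ^ (q ^ s)}"
proof -
  have "g \<noteq> 0" using primitive by (simp add: primitive_element_def)
  have "(1::'a) \<in> dickson_coset g q n 0"
    unfolding mem_dickson_coset_iff[OF \<open>g \<noteq> 0\<close> q_gt_1] by (intro exI[of _ 0]) simp
  from dickson_mult_eq[OF this] show ?thesis
    by (simp add: gen_dist_set_def dickson_mult_eq[OF assms(1)] dickson_mult_eq[OF assms(2)])
qed

end

section \<open>Common fixed points of iterated \<open>q\<close>-th powers, and the
  equivalence\<close>

lemma power_iterate_fixed:
  fixes x :: "'a::monoid_mult"
  assumes "x ^ (q ^ m) = x" 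
  shows "x ^ (q ^ (m * c)) = x"
proof (induction c)
  case (Suc c)
  have "x ^ (q ^ (m * Suc c)) = (x ^ (q ^ m)) ^ (q ^ (m * c))"
    by (simp add: power_add power_mult)
  then show ?case using Suc assms by simp
qed simp

lemma power_fixed_gcd:
  fixes x :: "'a::monoid_mult"
  assumes "x ^ (q ^ i) = x" "x ^ (q ^ j) = x"
  shows "x ^ (q ^ gcd i j) = x"
proof (cases "i = 0")
  case False
  \<comment> \<open>Bezout with nonnegative coefficients, which is why \<open>i = 0\<close> is
    treated apart.\<close>
  then obtain a c where ac: "i * a = j * c + gcd i j" using bezout_nat by blast
  have "x = x ^ (q ^ (i * a))" using power_iterate_fixed[OF assms(1)] by simp
  also have "\<dots> = (x ^ (q ^ (j * c))) ^ (q ^ gcd i j)" by (simp only: ac power_add power_mult)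
  finally show ?thesis using power_iterate_fixed[OF assms(2)] by simp
qed (use assms in simp)

lemma power_fixed_mono:
  fixes x :: "'a::monoid_mult"
  assumes "x ^ (q ^ m) = x" "m dvd k"
  shows "x ^ (q ^ k) = x"
proof -
  obtain c where "k = m * c" using assms(2) by (rule dvdE)
  then show ?thesis using power_iterate_fixed[OF assms(1)] by simp
qed

theorem corollary10:
  fixes g b :: "'a::{field,finite}"
    and B D :: "'a set"
    and p l q n s t \<mu> :: nat
  assumes "dickson_pair q n"
    and "prime p"
    and "q = p ^ l"
    and "n > 2"
    and "card (UNIV :: 'a set) = q ^ n"
    and "primitive_element g"
    and "b \<noteq> 0"
    and "1 + b \<noteq> 0"
    and "b \<in> dickson_coset g q n s"
    and "1 + b \<in> dickson_coset g q n t"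
    and "\<mu> = gcd s (gcd t n)"
    and "D = gen_dist_set g q n 1 b"
    and "prime_basis B D"
  shows "((\<forall>x\<in>D. \<forall>y\<in>D. x * y \<in> D) \<longleftrightarrow> is_subfield D) \<and>
         ((\<forall>x\<in>D. \<forall>y\<in>D. x * y \<in> D) \<longleftrightarrow> (\<forall>u\<in>B. u ^ 2 \<in> D)) \<and>
         ((\<forall>u\<in>B. u ^ 2 \<in> D) \<longleftrightarrow> card B = l * \<mu>)"
proof -
  interpret dickson g q n
    by (rule dickson.intro) fact+
  have D: "D = {d. (1 + b) * d ^ (q ^ t) = d + b * d ^ (q ^ s)}"
    unfolding \<open>D = _\<close> by (rule gen_dist_set_one) fact+
  have card_p: "CARD('a) = p ^ (l * n)" by (simp only: card \<open>q = _\<close> power_mult)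
  have CHAR: "CHAR('a) = p" using CHAR_eq_of_CARD_eq_power[OF card_p \<open>prime p\<close>] .
  define K where "K = {x::'a. x ^ (q ^ \<mu>) = x}"
  have K_subfield: "is_subfield K"
    unfolding K_def using \<open>prime p\<close>
    by (intro is_subfield_power_fixed_points[where k = "l * \<mu>"])
      (simp_all only: CHAR \<open>q = _\<close> power_mult)
  have \<mu>: "\<mu> dvd s" "\<mu> dvd t" "\<mu> dvd n" "\<mu> > 0"
    using n_pos by (auto simp: \<open>\<mu> = _\<close>) (meson dvd_trans gcd_dvd1 gcd_dvd2)+
  then have card_K: "card K = q ^ \<mu>"
    unfolding K_def using card_power_fixed_points[OF card] \<mu> q_gt_1 by blast
  have card_D: "card D = p ^ card B"
    using card_prime_basis[OF card_p] \<open>prime p\<close> \<open>prime_basis B D\<close> .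
  have "q ^ \<mu> = p ^ (l * \<mu>)" by (simp only: \<open>q = _\<close> power_mult)
  then have card_iff: "card B = l * \<mu> \<longleftrightarrow> card D = card K"
    using card_D card_K power_inject_exp[of p] prime_gt_1_nat[OF \<open>prime p\<close>] by simp
  \<comment> \<open>The third argument \<open>n\<close> of the gcd costs nothing, since every
    element is fixed by the \<open>q ^ n\<close>-th power.\<close>
  have fix_iff: "x \<in> K \<longleftrightarrow> x ^ (q ^ s) = x \<and> x ^ (q ^ t) = x" for x
  proof
    assume "x \<in> K"
    then show "x ^ (q ^ s) = x \<and> x ^ (q ^ t) = x"
      using power_fixed_mono[of x q \<mu>] \<mu> by (simp add: K_def)
  next
    assume "x ^ (q ^ s) = x \<and> x ^ (q ^ t) = x"
    moreover have "x ^ (q ^ n) = x" using power_card_eq_self[of x] card by simp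
    ultimately show "x \<in> K"
      unfolding K_def \<open>\<mu> = _\<close> by (simp add: power_fixed_gcd)
  qed
  have "K \<subseteq> D"
    using fix_iff by (auto simp: D algebra_simps)
  \<comment> \<open>With \<open>\<lambda> = 1 / (1 + b)\<close>, the two memberships say that \<open>y\<close> and \<open>y\<^sup>2\<close> are the means of
    \<open>u, x\<close> and of \<open>u\<^sup>2, x\<^sup>2\<close> for the weights \<open>\<lambda>, 1 - \<lambda>\<close>; so the variance \<open>\<lambda> (1 - \<lambda>) (u - x)\<^sup>2\<close>
    vanishes.\<close>
  have square: "u \<in> K" if "u \<in> D" "u ^ 2 \<in> D" for u
  proof -
    define x y where "x = u ^ (q ^ s)" and "y = u ^ (q ^ t)"
    have 1: "(1 + b) * y = u + b * x" using that by (simp add: D x_def y_def)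
    have 2: "(1 + b) * y ^ 2 = u ^ 2 + b * x ^ 2"
      using that by (simp add: D x_def y_def mult.commute flip: power_mult)
    \<comment> \<open>The variance multiplied by \<open>(1 + b) ^ 2\<close>, which clears the
      denominators.\<close>
    have "b * (u - x) ^ 2 = (1 + b) * (u ^ 2 + b * x ^ 2) - (u + b * x) ^ 2"
      by (simp add: algebra_simps power2_eq_square)
    also have "\<dots> = (1 + b) * ((1 + b) * y ^ 2) - ((1 + b) * y) ^ 2"
      using 1 2 by simp
    also have "\<dots> = 0" by (simp add: power2_eq_square)
    finally have "x = u" using \<open>b \<noteq> 0\<close> by simp
    with 1 have "(1 + b) * y = (1 + b) * u" by (simp add: algebra_simps)
    then have "y = u" using \<open>1 + b \<noteq> 0\<close> by (metis mult_cancel_left)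
    then show ?thesis using \<open>x = u\<close> by (simp add: fix_iff x_def y_def)
  qed
  have span: "prime_vs.span B = D" using \<open>prime_basis B D\<close> by (simp add: prime_basis_def)
  then have "B \<subseteq> D" using prime_vs.span_superset by blast
  have squares: "D = K" if "\<forall>u\<in>B. u ^ 2 \<in> D"
  proof -
    \<comment> \<open>Testing squares on the basis suffices: once \<open>B\<close> lies in the
      subfield \<open>K\<close>, so does its span \<open>D\<close>.\<close>
    have "B \<subseteq> K" using that square \<open>B \<subseteq> D\<close> by blast
    then show ?thesis
      using prime_span_subset_subfield[OF K_subfield] span \<open>K \<subseteq> D\<close> by blast
  qed
  have cards: "D = K" if "card D = card K"
    using card_subset_eq[of D K] \<open>K \<subseteq> D\<close> that by simp
  have closed_squares: "\<forall>u\<in>B. u ^ 2 \<in> D" if "\<forall>x\<in>D. \<forall>y\<in>D. x * y \<in> D"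
    using that \<open>B \<subseteq> D\<close> by (auto simp: power2_eq_square)
  have subfield_closed: "\<forall>x\<in>D. \<forall>y\<in>D. x * y \<in> D" if "is_subfield D"
    using that by (simp add: is_subfield_def)
  show ?thesis
  \<comment> \<open>If \<open>D = K\<close>, all the conditions hold; otherwise each of them fails,
    as each would force \<open>D = K\<close>.\<close>
  proof (cases "D = K")
    case True
    then have "is_subfield D" "card B = l * \<mu>" using K_subfield card_iff by simp_all
    then show ?thesis using subfield_closed closed_squares by blast
  next
    case False
    then show ?thesis using squares cards closed_squares subfield_closed card_iff by blast
  qed
qed

end
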